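(* Every connected graph $G$ on $n$ vertices with maximum degree $\Delta$ satisfies $\gamma_I^p(G)\ge 2n/(\Delta+2)$.
   Context: For a graph $G=(V,E)$ and $v\in V$, $N(v)$ denotes the set of neighbours of $v$. A perfect Italian dominating function (PID-function) of $G$ is a function $f:V\to\{0,1,2\}$ such that for every vertex $v$ with $f(v)=0$ one has $\sum_{u\in N(v)} f(u)=2$. The weight of $f$ is $\sum_{v\in V} f(v)$; $\gamma_I^p(G)$ is the minimum weight of a PID-function of $G$. *)

theory Defs
  imports Complex_Main "Graph_Theory.Graph_Theory"
begin

(* In the Graph_Theory library a finite simple graph is a finite symmetric digraph without
   loops and parallel arcs (locale graph): an edge {u,v} is the pair of arcs (u,v), (v,u). *)

definition neighbours :: "('a, 'b) pre_digraph \<Rightarrow> 'a \<Rightarrow> 'a set" where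
  "neighbours G v = {u. v \<rightarrow>\<^bsub>G\<^esub> u}"

definition degree :: "('a, 'b) pre_digraph \<Rightarrow> 'a \<Rightarrow> nat" where
  "degree G v = card (neighbours G v)"

definition max_degree :: "('a, 'b) pre_digraph \<Rightarrow> nat" where
  "max_degree G = Max (degree G ` verts G)"

(* Only the values of f on verts G matter, here and in weight. *)
definition PID_function :: "('a, 'b) pre_digraph \<Rightarrow> ('a \<Rightarrow> nat) \<Rightarrow> bool" where
  "PID_function G f \<longleftrightarrow>
     (\<forall>v \<in> verts G. f v \<in> {0, 1, 2}) \<and>
     (\<forall>v \<in> verts G. f v = 0 \<longrightarrow> (\<Sum>u \<in> neighbours G v. f u) = 2)"

definition weight :: "('a, 'b) pre_digraph \<Rightarrow> ('a \<Rightarrow> nat) \<Rightarrow> nat" where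
  "weight G f = (\<Sum>v \<in> verts G. f v)"

definition PID_number :: "('a, 'b) pre_digraph \<Rightarrow> nat" where
  "PID_number G = (LEAST w. \<exists>f. PID_function G f \<and> weight G f = w)"

(* The minimum in PID_number is over a nonempty set. *)
lemma PID_function_const_1: "PID_function G (\<lambda>_. 1)"
  by (simp add: PID_function_def)

lemma (in graph) degree_eq_out_degree: "degree G v = out_degree G v"
proof -
  have "neighbours G v = head G ` out_arcs G v"
    by (auto simp: neighbours_def arcs_ends_conv out_arcs_def image_iff)
  moreover have "inj_on (head G) (out_arcs G v)"
    by (auto intro!: inj_onI no_multi_arcs simp: arc_to_ends_def)
  ultimately show ?thesis
    by (simp add: degree_def out_degree_def card_image)
qed

end

theory Submission
  imports Defs
begin

text \<open>Double counting the value that the zero set of a PID-function f receives from its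
  neighbours: each zero receives 2 in total, while each vertex u hands out f(u) at most
  max-degree many times. The vertices outside the zero set number at most the weight of f.\<close>

lemma (in graph) neighbours_subset_verts: "neighbours G v \<subseteq> verts G"
  by (auto simp: neighbours_def)

lemma (in graph) finite_neighbours: "finite (neighbours G v)"
  using neighbours_subset_verts finite_verts by (rule finite_subset)

lemma (in graph) neighbours_sym: "u \<in> neighbours G v \<longleftrightarrow> v \<in> neighbours G u"
  by (auto simp: neighbours_def dest: graph_symmetric)

lemma (in graph) card_neighbours_le_max_degree:
  assumes "v \<in> verts G"
  shows "card (neighbours G v) \<le> max_degree G"
  using assms by (auto simp: max_degree_def simp flip: degree_def)

text \<open>The denominator is cleared so that the counting stays in the natural numbers.\<close>

lemma (in graph) PID_function_weight_ge:
  assumes "PID_function G f"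
  shows "2 * card (verts G) \<le> (max_degree G + 2) * weight G f"
proof -
  let ?Z = "{v \<in> verts G. f v = 0}" and ?P = "{v \<in> verts G. f v \<noteq> 0}"
  have "2 * card ?Z = (\<Sum>v\<in>?Z. \<Sum>u\<in>neighbours G v. f u)"
    using assms by (simp add: PID_function_def)
  \<comment> \<open>Ranging over \<open>verts G\<close> with adjacency as a filter makes the inner
    index set independent of \<open>v\<close>, the shape that \<open>sum.swap_restrict\<close>
    exchanges.\<close>
  also have "\<dots> = (\<Sum>v\<in>?Z. \<Sum>u | u \<in> verts G \<and> u \<in> neighbours G v. f u)"
    using neighbours_subset_verts by (intro sum.cong refl) auto
  also have "\<dots> = (\<Sum>u\<in>verts G. \<Sum>v | v \<in> ?Z \<and> u \<in> neighbours G v. f u)"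
    by (rule sum.swap_restrict) auto
  also have "\<dots> = (\<Sum>u\<in>verts G. card {v \<in> ?Z. u \<in> neighbours G v} * f u)"
    by simp
  also have "\<dots> \<le> (\<Sum>u\<in>verts G. max_degree G * f u)"
  proof (intro sum_mono mult_right_mono)
    fix u assume u: "u \<in> verts G"
    \<comment> \<open>By symmetry of adjacency, the zeros that receive from \<open>u\<close> are
      themselves neighbours of \<open>u\<close>.\<close>
    have "card {v \<in> ?Z. u \<in> neighbours G v} \<le> card (neighbours G u)"
      using neighbours_sym by (intro card_mono finite_neighbours) auto
    also have "\<dots> \<le> max_degree G"
      by (rule card_neighbours_le_max_degree[OF u])
    finally show "card {v \<in> ?Z. u \<in> neighbours G v} \<le> max_degree G" .
  qed simp
  also have "\<dots> = max_degree G * weight G f"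
    by (simp add: weight_def sum_distrib_left)
  finally have Z: "2 * card ?Z \<le> max_degree G * weight G f" .
  have "card ?P = (\<Sum>v\<in>?P. 1)"
    by simp
  \<comment> \<open>A nonzero natural number is at least 1.\<close>
  also have "\<dots> \<le> (\<Sum>v\<in>?P. f v)"
    by (rule sum_mono) auto
  also have "\<dots> \<le> weight G f"
    unfolding weight_def by (rule sum_mono2) auto
  finally have P: "card ?P \<le> weight G f" .
  have "card (verts G) = card (?Z \<union> ?P)"
    by (rule arg_cong[of _ _ card]) auto
  also have "\<dots> = card ?Z + card ?P"
    by (rule card_Un_disjoint) auto
  \<comment> \<open>Adding \<open>Z\<close> to twice \<open>P\<close> produces the factor \<Delta> +
    2.\<close>
  finally show ?thesis
    using Z P by (simp add: algebra_simps)
qed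

text \<open>The constant function 1 is a PID-function, so \<open>LEAST\<close> ranges over a
  nonempty set of weights and picks one of them.\<close>

lemma PID_number_attained:
  obtains f where "PID_function G f" and "weight G f = PID_number G"
proof -
  have "\<exists>f. PID_function G f \<and> weight G f = PID_number G"
    unfolding PID_number_def by (rule LeastI_ex) (use PID_function_const_1 in blast)
  then show ?thesis
    using that by blast
qed

theorem theorem29:
  fixes G :: "('a, 'b) pre_digraph"
    and n \<Delta> :: nat
  assumes "graph G"
    and "Digraph_Component.connected G"
    and "n = card (verts G)"
    and "\<Delta> = max_degree G"
  shows "real (PID_number G) \<ge> 2 * real n / (real \<Delta> + 2)"
proof -
  obtain f where "PID_function G f" and "weight G f = PID_number G"
    by (rule PID_number_attained)
  then have "2 * n \<le> (\<Delta> + 2) * PID_number G"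
    using graph.PID_function_weight_ge[OF assms(1)] assms(3,4) by metis
  then have "real (2 * n) \<le> real ((\<Delta> + 2) * PID_number G)"
    by (rule of_nat_mono)
  \<comment> \<open>Dividing is safe because \<Delta> + 2 is positive even for \<Delta> = 0.\<close>
  then show ?thesis
    by (simp add: divide_le_eq algebra_simps)
qed

end
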